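(* Let $f:\mathbb{R}^n\to\mathbb{R}$ be continuously differentiable with gradient Lipschitz continuous on the unit simplex $\Delta$ with constant $L>0$. Let $C>0$ and let the parameter $\epsilon$ of the active-set estimate satisfy $0<\epsilon\le \frac{2}{nL(2C+1)}$. Let $\{x^k\}$ be the sequence of points produced by the algorithm AS-SIMPLEX (described in the context), where the sequence of directions $\{d^k\}$ is active-set gradient related and the stepsize $\alpha^k$ is computed using the Armijo line search. Then either there is an integer $\bar k\ge 0$ such that $x^{\bar k}$ is a stationary point of the problem $\min_{x\in\Delta} f(x)$, or the sequence $\{x^k\}$ is infinite and every limit point $x^*$ of the sequence is a stationary point of $\min_{x\in\Delta} f(x)$.
   Context: Setting. $\Delta=\{x\in\mathbb{R}^n: e^Tx=1,\ x\ge 0\}$, where $e$ is the all-ones vector; $e_i$ is the $i$th unit vector; $v_I$ is the subvector of $v$ with components indexed by $I$. For $I\subseteq\{1,\dots,n\}$, $\Delta_I=\{x\in\Delta: x_i=0\ \forall i\notin I\}$. A point $x^*\in\Delta$ is stationary (for $\min_\Delta f$) if there are $\lambda^*\in\mathbb{R}$, $\mu^*\in\mathbb{R}^n$ with $\nabla f(x^* )-\lambda^*e-\mu^*=0$, $(\mu^* )^Tx^*=0$, $\mu^*\ge0$; equivalently $\nabla f(x^* )^T(e_i-x^* )\ge 0$ for all $i$. A point $x^*\in\Delta_I$ is stationary in $\Delta_I$ if $\nabla f(x^* )^T(y-x^* )\ge0$ for all $y\in\Delta_I$. Active-set estimate. For $x\in\Delta$ and the fixed parameter $\epsilon>0$: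 $A(x)=\{i: x_i\le\epsilon\nabla f(x)^T(e_i-x)\}$, $N(x)=\{i: x_i>\epsilon\nabla f(x)^T(e_i-x)\}$, and $J(x)=\operatorname{Argmin}_{i=1,\dots,n}\nabla_i f(x)$. Algorithm AS-SIMPLEX. Choose $x^0\in\Delta$. For $k=0,1,\dots$: if $x^k$ is stationary, stop. Otherwise set $A^k=A(x^k)$, $N^k=N(x^k)$, choose $j\in J(x^k)$ (for non-stationary $x^k$ one has $J(x^k)\subseteq N(x^k)$), and set $\tilde x^k_{A^k}=0$, $\tilde x^k_{i}=x^k_{i}$ for $i\in N^k\setminus\{j\}$, $\tilde x^k_j=x^k_j+\sum_{h\in A^k}x^k_h$. Compute a direction $d^k$ that is feasible for $\Delta$ at $\tilde x^k$ and satisfies $d^k_{A^k}=0$. If $\nabla f(\tilde x^k)^Td^k<0$, compute a stepsize $\alpha^k\in(0,\alpha^k_{\max}]$ by a line search; otherwise set $\alpha^k=0$. Set $x^{k+1}=\tilde x^k+\alpha^kd^k$. Here $\alpha^k_{\max}$ is the maximum feasible stepsize, i.e. the largest $\alpha$ with $\tilde x^k+\alpha d^k\in\Delta$. Armijo line search. With fixed $\delta,\gamma\in(0,1)$: start from $\alpha=\alpha^k_{\max}$; while $f(\tilde x^k+\alpha d^k)>f(\tilde x^k)+\gamma\alpha\nabla f(\tilde x^k)^Td^k$, replace $\alpha$ by $\delta\alpha$; the final $\alpha$ is $\alpha^k$. Active-set gradient related directions. Given an infinite sequence $\{x^k\}$ produced by AS-SIMPLEX, $\{d^k\}$ is active-set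 gradient related if for every subsequence $\{x^k\}_K$ such that $N(x^k)=\hat N$ for all $k\in K$ and $\lim_{k\to\infty,k\in K}x^k=x^*$ with $x^*$ non-stationary in $\Delta_{\hat N}$, one has: $\{d^k_{\hat N}\}_K$ is bounded; $\limsup_{k\to\infty,k\in K}\nabla_{\hat N}f(\tilde x^k)^Td^k_{\hat N}<0$; and $\liminf_{k\to\infty,k\in K}\alpha^k_{\max}>0$. *)

theory Defs
  imports "HOL-Analysis.Analysis" "HOL-Library.While_Combinator"
begin

definition gradient :: "(real^'n \<Rightarrow> real) \<Rightarrow> real^'n \<Rightarrow> real^'n" where
  "gradient f x = (THE v. GDERIV f x :> v)"

lemma gradient_eqI: "GDERIV f x :> v \<Longrightarrow> gradient f x = v"
  unfolding gradient_def
proof (rule the_equality)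
  fix w assume v: "GDERIV f x :> v" and w: "GDERIV f x :> w"
  have "(\<lambda>h. inner h w) = (\<lambda>h. inner h v)"
    using w v unfolding gderiv_def by (rule has_derivative_unique)
  then have "inner h w = inner h v" for h by metis
  then show "w = v" by (metis vector_eq_ldot)
qed

lemma gradient_works: "f differentiable (at x) \<Longrightarrow> GDERIV f x :> gradient f x"
proof -
  assume "f differentiable (at x)"
  then obtain D where D: "(f has_derivative D) (at x)"
    unfolding differentiable_def by blast
  then interpret bounded_linear D by (rule has_derivative_bounded_linear)
  have "inner h (adjoint D 1) = D h" for h
    using adjoint_works[OF linear_axioms, of h 1] by simp
  then have "D = (\<lambda>h. inner h (adjoint D 1))" by auto
  then have "GDERIV f x :> adjoint D 1" using D unfolding gderiv_def by simp
  then show ?thesis using gradient_eqI by metis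
qed

definition unit_simplex :: "(real^'n) set" where
  "unit_simplex = {x. (\<Sum>i\<in>UNIV. x $ i) = 1 \<and> (\<forall>i. 0 \<le> x $ i)}"

definition simplex_face :: "'n set \<Rightarrow> (real^'n) set" where
  "simplex_face I = {x \<in> unit_simplex. \<forall>i. i \<notin> I \<longrightarrow> x $ i = 0}"

definition stationary :: "(real^'n \<Rightarrow> real) \<Rightarrow> real^'n \<Rightarrow> bool" where
  "stationary f x \<longleftrightarrow> x \<in> unit_simplex \<and>
     (\<exists>(lam::real) (mu::real^'n).
        gradient f x - lam *\<^sub>R (\<chi> i. 1) - mu = 0 \<and> inner mu x = 0 \<and> (\<forall>i. 0 \<le> mu $ i))"

definition stationary_in_face :: "(real^'n \<Rightarrow> real) \<Rightarrow> 'n set \<Rightarrow> real^'n \<Rightarrow> bool" where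
  "stationary_in_face f I x \<longleftrightarrow> x \<in> simplex_face I \<and>
     (\<forall>y\<in>simplex_face I. inner (gradient f x) (y - x) \<ge> 0)"

definition active_set :: "(real^'n \<Rightarrow> real) \<Rightarrow> real \<Rightarrow> real^'n \<Rightarrow> 'n set" where
  "active_set f eps x = {i. x $ i \<le> eps * inner (gradient f x) (axis i 1 - x)}"

definition nonactive_set :: "(real^'n \<Rightarrow> real) \<Rightarrow> real \<Rightarrow> real^'n \<Rightarrow> 'n set" where
  "nonactive_set f eps x = {i. x $ i > eps * inner (gradient f x) (axis i 1 - x)}"

definition argmin_gradient :: "(real^'n \<Rightarrow> real) \<Rightarrow> real^'n \<Rightarrow> 'n set" where
  "argmin_gradient f x = {j. \<forall>i. gradient f x $ j \<le> gradient f x $ i}"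

text \<open>The index \<open>j\<close> is tested first, but the clauses do not overlap where the algorithm uses
  them: at a non-stationary \<open>x\<close>, every \<open>j \<in> argmin_gradient f x\<close> is nonactive.\<close>

definition active_set_update :: "(real^'n \<Rightarrow> real) \<Rightarrow> real \<Rightarrow> 'n \<Rightarrow> real^'n \<Rightarrow> real^'n" where
  "active_set_update f eps j x =
     (\<chi> i. if i = j then x $ j + (\<Sum>h\<in>active_set f eps x. x $ h)
           else if i \<in> active_set f eps x then 0 else x $ i)"

definition feasible_direction :: "real^'n \<Rightarrow> real^'n \<Rightarrow> bool" where
  "feasible_direction x d \<longleftrightarrow> (\<exists>t>0. \<forall>a\<in>{0..t}. x + a *\<^sub>R d \<in> unit_simplex)"

text \<open>The supremum is attained, hence is the largest feasible stepsize, whenever \<open>x\<close> lies in the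
  simplex and \<open>d \<noteq> 0\<close>; it is \<open>\<infinity>\<close> for \<open>d = 0\<close>, in which case no line search is performed.\<close>

definition max_stepsize :: "real^'n \<Rightarrow> real^'n \<Rightarrow> ereal" where
  "max_stepsize x d = (SUP a\<in>{a::real. x + a *\<^sub>R d \<in> unit_simplex}. ereal a)"

text \<open>The outcome is \<open>None\<close> if the backtracking loop does not terminate.\<close>

definition armijo_search ::
  "(real^'n \<Rightarrow> real) \<Rightarrow> real \<Rightarrow> real \<Rightarrow> real^'n \<Rightarrow> real^'n \<Rightarrow> real option" where
  "armijo_search f del gam x d =
     while_option (\<lambda>a. f (x + a *\<^sub>R d) > f x + gam * a * inner (gradient f x) d)
       (\<lambda>a. del * a) (real_of_ereal (max_stepsize x d))"

definition armijo_stepsize ::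
  "(real^'n \<Rightarrow> real) \<Rightarrow> real \<Rightarrow> real \<Rightarrow> real^'n \<Rightarrow> real^'n \<Rightarrow> real option" where
  "armijo_stepsize f del gam x d =
     (if inner (gradient f x) d < 0 then armijo_search f del gam x d else Some 0)"

definition direction_step ::
  "(real^'n \<Rightarrow> real) \<Rightarrow> real \<Rightarrow> real^'n \<Rightarrow> real^'n \<Rightarrow> real^'n \<Rightarrow> bool" where
  "direction_step f eps x xt d \<longleftrightarrow>
     (\<exists>j\<in>argmin_gradient f x. xt = active_set_update f eps j x) \<and>
     feasible_direction xt d \<and> (\<forall>i\<in>active_set f eps x. d $ i = 0)"

text \<open>A complete run with iterates \<open>x 0, \<dots>, x T\<close> (all \<open>x k\<close> if \<open>T = \<infinity>\<close>); values of the sequences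
  beyond that are irrelevant. A finite run ends either because the last iterate is stationary or
  because its line search does not terminate. The latter is not excluded by definition, so that
  the existence of infinitely many iterates is something to be proved.\<close>

definition as_simplex_run ::
  "(real^'n \<Rightarrow> real) \<Rightarrow> real \<Rightarrow> real \<Rightarrow> real \<Rightarrow> enat \<Rightarrow> (nat \<Rightarrow> real^'n) \<Rightarrow> (nat \<Rightarrow> real^'n) \<Rightarrow>
   (nat \<Rightarrow> real^'n) \<Rightarrow> (nat \<Rightarrow> real) \<Rightarrow> bool" where
  "as_simplex_run f eps del gam T x xt d alpha \<longleftrightarrow>
     x 0 \<in> unit_simplex \<and>
     (\<forall>k. enat k < T \<longrightarrow>
        \<not> stationary f (x k) \<and>
        direction_step f eps (x k) (xt k) (d k) \<and>
        armijo_stepsize f del gam (xt k) (d k) = Some (alpha k) \<and>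
        x (Suc k) = xt k + alpha k *\<^sub>R d k) \<and>
     (\<forall>k. T = enat k \<longrightarrow>
        stationary f (x k) \<or>
        direction_step f eps (x k) (xt k) (d k) \<and>
        armijo_stepsize f del gam (xt k) (d k) = None)"

text \<open>Subvectors indexed by \<open>I\<close> are represented by padding with zeros.\<close>

definition subvector :: "'n set \<Rightarrow> real^'n \<Rightarrow> real^'n" where
  "subvector I v = (\<chi> i. if i \<in> I then v $ i else 0)"

definition active_set_gradient_related ::
  "(real^'n \<Rightarrow> real) \<Rightarrow> real \<Rightarrow> (nat \<Rightarrow> real^'n) \<Rightarrow> (nat \<Rightarrow> real^'n) \<Rightarrow> (nat \<Rightarrow> real^'n) \<Rightarrow> bool" where
  "active_set_gradient_related f eps x xt d \<longleftrightarrow>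
     (\<forall>(r::nat \<Rightarrow> nat) I xs.
        strict_mono r \<and> (\<forall>k. nonactive_set f eps (x (r k)) = I) \<and>
        (\<lambda>k. x (r k)) \<longlonglongrightarrow> xs \<and> xs \<in> simplex_face I \<and> \<not> stationary_in_face f I xs \<longrightarrow>
        bounded (range (\<lambda>k. subvector I (d (r k)))) \<and>
        limsup (\<lambda>k. ereal (inner (subvector I (gradient f (xt (r k)))) (subvector I (d (r k))))) < 0 \<and>
        liminf (\<lambda>k. max_stepsize (xt (r k)) (d (r k))) > 0)"

definition seq_limit_point :: "(nat \<Rightarrow> real^'n) \<Rightarrow> real^'n \<Rightarrow> bool" where
  "seq_limit_point x xs \<longleftrightarrow> (\<exists>r::nat \<Rightarrow> nat. strict_mono r \<and> (\<lambda>k. x (r k)) \<longlonglongrightarrow> xs)"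

end

theory Submission
  imports Defs
begin

text \<open>Resetting the estimated active variables decreases \<open>f\<close> by at least \<open>C L \<parallel>xt - x\<parallel>\<^sup>2\<close>: to first
  order the decrease is at least \<open>(\<Sum>x\<^sub>h\<^sup>2) / \<epsilon>\<close> over the active \<open>h\<close>, and the bound on \<open>\<epsilon>\<close> makes this
  dominate the quadratic remainder of the descent lemma. The values \<open>f (x k)\<close> therefore decrease
  and converge, so \<open>xt k - x k\<close> tends to zero. Consequently a limit point along a subsequence with
  constant nonactive set \<open>I\<close> lies in the face of \<open>I\<close>. If it were not stationary in this face, the
  Armijo stepsizes would stay away from zero, contradicting the convergence of \<open>f (x k)\<close>. For the
  remaining indices the inequality defining the active set passes to the limit.\<close>

section \<open>The unit simplex\<close>

lemma convex_unit_simplex: "convex (unit_simplex :: (real^'n) set)"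
  unfolding unit_simplex_def convex_alt
  by (auto simp: sum.distrib sum_distrib_left[symmetric])

lemma closed_unit_simplex: "closed (unit_simplex :: (real^'n) set)"
  unfolding unit_simplex_def
  by (intro closed_Collect_conj closed_Collect_all closed_Collect_eq closed_Collect_le continuous_intros)

lemma unit_simplex_norm_le: "x \<in> unit_simplex \<Longrightarrow> norm (x :: real^'n) \<le> 1"
  using norm_le_l1_cart[of x] by (simp add: unit_simplex_def)

lemma compact_unit_simplex: "compact (unit_simplex :: (real^'n) set)"
  using closed_unit_simplex unit_simplex_norm_le
  by (auto simp: compact_eq_bounded_closed bounded_iff)

lemma axis_in_simplex_face: "i \<in> I \<Longrightarrow> axis i 1 \<in> simplex_face I"
  by (auto simp: simplex_face_def unit_simplex_def axis_def)

lemma inner_axis_diff: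
  fixes g x :: "real^'n"
  shows "inner g (axis i 1 - x) = g $ i - inner g x"
  by (simp add: inner_diff_right inner_axis)

text \<open>The point is the convex combination of \<open>x\<close> and
  \<open>x + m *\<^sub>R d\<close> with weight \<open>a/m\<close>; if \<open>m = 0\<close> then
  \<open>a = 0\<close> as well.\<close>

lemma unit_simplex_stepI:
  assumes "x \<in> unit_simplex" "x + m *\<^sub>R d \<in> unit_simplex" "0 \<le> a" "a \<le> m"
  shows "x + a *\<^sub>R d \<in> unit_simplex"
proof (cases "m = 0")
  case False
  with assms have m: "m > 0" by simp
  have "(1 - a/m) *\<^sub>R x + (a/m) *\<^sub>R (x + m *\<^sub>R d) \<in> unit_simplex"
    using assms m by (intro convexD_alt[OF convex_unit_simplex]) auto
  also have "(1 - a/m) *\<^sub>R x + (a/m) *\<^sub>R (x + m *\<^sub>R d) = x + a *\<^sub>R d"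
    using m by (simp add: algebra_simps)
  finally show ?thesis .
qed (use assms in auto)

text \<open>The multiplier of the equality constraint is \<open>inner g x\<close>. The components of
  \<open>mu\<close> are then exactly the assumed nonnegative quantities, and complementarity holds
  because the components of \<open>x\<close> sum to 1.\<close>

lemma stationaryI:
  assumes x: "x \<in> unit_simplex" and i: "\<And>i. inner (gradient f x) (axis i 1 - x) \<ge> 0"
  shows "stationary f x"
proof -
  define g where "g = gradient f x"
  define mu where "mu = g - inner g x *\<^sub>R (\<chi> i. 1)"
  have "inner (\<chi> i. 1) x = 1"
    using x by (simp add: inner_vec_def unit_simplex_def)
  then have "inner mu x = 0"
    by (simp add: mu_def inner_diff_left)
  moreover have "0 \<le> mu $ i" for i
    using i[of i] by (simp add: mu_def inner_axis_diff g_def)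
  moreover have "g - inner g x *\<^sub>R (\<chi> i. 1) - mu = 0"
    by (simp add: mu_def)
  ultimately show ?thesis
    using x unfolding stationary_def g_def[symmetric] by blast
qed

section \<open>The active-set update\<close>

text \<open>On the simplex \<open>inner (gradient f x) x\<close> is a weighted mean of the gradient
  components, so it is at least their minimum.\<close>

lemma argmin_gradient_le_inner:
  assumes x: "x \<in> unit_simplex" and j: "j \<in> argmin_gradient f x"
  shows "gradient f x $ j \<le> inner (gradient f x) x"
proof -
  have "gradient f x $ j = (\<Sum>i\<in>UNIV. gradient f x $ j * x $ i)"
    using x by (simp add: unit_simplex_def flip: sum_distrib_left)
  also have "\<dots> \<le> (\<Sum>i\<in>UNIV. gradient f x $ i * x $ i)"
    using x j by (intro sum_mono mult_right_mono) (auto simp: unit_simplex_def argmin_gradient_def)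
  finally show ?thesis by (simp add: inner_vec_def)
qed

text \<open>Some vertex direction is a descent direction by \<open>stationaryI\<close>, hence so is
  the one towards the vertex of the smallest gradient component. The threshold in the active-set
  test at \<open>j\<close> is thus negative, while \<open>x $ j\<close> is not.\<close>

lemma argmin_gradient_not_active:
  assumes x: "x \<in> unit_simplex" "\<not> stationary f x" and j: "j \<in> argmin_gradient f x"
    and eps: "0 < eps"
  shows "j \<notin> active_set f eps x"
proof -
  obtain i where i: "inner (gradient f x) (axis i 1 - x) < 0"
    using stationaryI[OF x(1), of f] x(2) by (meson not_le)
  have "gradient f x $ j \<le> gradient f x $ i"
    using j by (simp add: argmin_gradient_def)
  then have "inner (gradient f x) (axis j 1 - x) < 0"
    using i by (simp add: inner_axis_diff)
  then have "eps * inner (gradient f x) (axis j 1 - x) < 0"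
    using eps by (simp add: mult_pos_neg)
  then show ?thesis
    using x by (auto simp: active_set_def unit_simplex_def not_le intro: less_le_trans)
qed

text \<open>On the segment from \<open>x\<close> to \<open>y\<close>, \<open>p\<close> is
  \<open>f\<close> minus the varying part of the quadratic upper model. Cauchy-Schwarz and the
  Lipschitz bound make its derivative nonpositive, so \<open>p 1 \<le> p 0\<close>.\<close>

lemma descent_lemma:
  fixes f :: "real^'n \<Rightarrow> real"
  assumes diff: "\<And>y. f differentiable (at y)"
    and S: "convex S" and lip: "L-lipschitz_on S (gradient f)"
    and x: "x \<in> S" and y: "y \<in> S"
  shows "f y \<le> f x + inner (gradient f x) (y - x) + L / 2 * (norm (y - x))\<^sup>2"
proof -
  define v where "v = y - x"
  define p where "p = (\<lambda>t. f (x + t *\<^sub>R v) - t * inner (gradient f x) v - L / 2 * t\<^sup>2 * (norm v)\<^sup>2)"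
  define p' where "p' = (\<lambda>t. inner (gradient f (x + t *\<^sub>R v)) v - inner (gradient f x) v - L * t * (norm v)\<^sup>2)"
  have deriv: "(p has_real_derivative p' t) (at t)" for t
  proof -
    have "(f has_derivative (\<lambda>h. inner h (gradient f (x + t *\<^sub>R v)))) (at (x + t *\<^sub>R v))"
      using gradient_works[OF diff] by (simp add: gderiv_def)
    then have "((\<lambda>t. f (x + t *\<^sub>R v)) has_derivative
        (\<lambda>h. inner (h *\<^sub>R v) (gradient f (x + t *\<^sub>R v)))) (at t)"
      by (rule has_derivative_compose[rotated]) (auto intro!: derivative_eq_intros)
    moreover have "(\<lambda>h. inner (h *\<^sub>R v) w) = (*) (inner w v)" for w
      by (simp add: fun_eq_iff inner_commute mult.commute)
    ultimately have "((\<lambda>t. f (x + t *\<^sub>R v)) has_real_derivative inner (gradient f (x + t *\<^sub>R v)) v) (at t)"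
      by (simp only: has_field_derivative_def)
    then show ?thesis
      unfolding p_def p'_def by (auto intro!: derivative_eq_intros)
  qed
  have nonpos: "p' t \<le> 0" if t: "0 \<le> t" "t \<le> 1" for t
  proof -
    \<comment> \<open>The Lipschitz bound is available only on \<open>S\<close>, so the segment must
      stay inside.\<close>
    have "(1 - t) *\<^sub>R x + t *\<^sub>R y \<in> S"
      using S x y t by (simp add: convex_alt)
    then have z: "x + t *\<^sub>R v \<in> S"
      by (simp add: v_def algebra_simps)
    have "inner (gradient f (x + t *\<^sub>R v) - gradient f x) v
        \<le> norm (gradient f (x + t *\<^sub>R v) - gradient f x) * norm v"
      by (rule norm_cauchy_schwarz)
    also have "\<dots> \<le> (L * (t * norm v)) * norm v"
      using lipschitz_onD[OF lip z x] t by (intro mult_right_mono) (auto simp: dist_norm)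
    also have "\<dots> = L * t * (norm v)\<^sup>2"
      by (simp add: power2_eq_square)
    finally show ?thesis
      by (simp add: p'_def inner_diff_left)
  qed
  have "p 1 \<le> p 0"
  proof (rule DERIV_nonpos_imp_nonincreasing[where f = p and a = 0 and b = 1])
    show "\<exists>y. (p has_real_derivative y) (at t) \<and> y \<le> 0" if "0 \<le> t" "t \<le> 1" for t
      using deriv[of t] nonpos[OF that] by blast
  qed simp
  then show ?thesis by (simp add: p_def v_def)
qed

text \<open>The update is \<open>x + (\<Sum>h. x\<^sub>h (e\<^sub>j - e\<^sub>h))\<close> over the active \<open>h\<close>. There are at most \<open>n - 1\<close> of these
  because \<open>j\<close> is nonactive; this is where the factor \<open>n\<close> comes from.\<close>

lemma active_set_update_first_order:
  fixes x :: "real^'n"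
  assumes x: "x \<in> unit_simplex" "\<not> stationary f x" and j: "j \<in> argmin_gradient f x"
    and eps: "0 < eps"
  shows "(norm (active_set_update f eps j x - x))\<^sup>2
    \<le> real CARD('n) * (- eps * inner (gradient f x) (active_set_update f eps j x - x))"
proof -
  define g A where "g = gradient f x" and "A = active_set f eps x"
  define s where "s = (\<Sum>h\<in>A. x $ h)"
  define v where "v = active_set_update f eps j x - x"
  have jA: "j \<notin> A"
    using argmin_gradient_not_active[OF assms] by (simp add: A_def)
  have v: "v $ i = (if i = j then s else if i \<in> A then - x $ i else 0)" for i
    by (auto simp: v_def active_set_update_def s_def A_def)
  have vA: "v $ h = - x $ h" if "h \<in> A" for h
    using that jA by (auto simp: v)
  \<comment> \<open>Kept general in \<open>w\<close>: the choice \<open>w = v\<close> yields the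
    norm, \<open>w = g\<close> the first-order change.\<close>
  have inner_v: "inner w v = w $ j * s - (\<Sum>h\<in>A. w $ h * x $ h)" for w
  proof -
    have "inner w v = (\<Sum>i\<in>insert j A. w $ i * v $ i)"
      unfolding inner_vec_def inner_real_def by (rule sum.mono_neutral_right) (auto simp: v)
    also have "\<dots> = w $ j * v $ j + (\<Sum>h\<in>A. w $ h * v $ h)"
      using jA by (intro sum.insert) auto
    also have "(\<Sum>h\<in>A. w $ h * v $ h) = (\<Sum>h\<in>A. - (w $ h * x $ h))"
      by (intro sum.cong) (auto simp: vA)
    finally show ?thesis by (simp add: v sum_negf)
  qed
  have "(\<Sum>h\<in>A. v $ h * x $ h) = (\<Sum>h\<in>A. - (x $ h)\<^sup>2)"
    by (intro sum.cong) (auto simp: vA power2_eq_square)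
  moreover have "v $ j = s" by (simp add: v)
  ultimately have norm: "(norm v)\<^sup>2 = s\<^sup>2 + (\<Sum>h\<in>A. (x $ h)\<^sup>2)"
    unfolding power2_norm_eq_inner inner_v[of v] by (simp add: sum_negf power2_eq_square[of s])
  have gv: "inner g v = (\<Sum>h\<in>A. (g $ j - g $ h) * x $ h)"
    unfolding inner_v by (simp add: s_def sum_distrib_left left_diff_distrib sum_subtractf)
  \<comment> \<open>The active-set inequality is multiplied by \<open>x $ h\<close>, after
    \<open>inner g x\<close> is replaced by the smaller \<open>g $ j\<close>.\<close>
  have "(\<Sum>h\<in>A. (x $ h)\<^sup>2) \<le> (\<Sum>h\<in>A. eps * (g $ h - g $ j) * x $ h)"
  proof (rule sum_mono)
    fix h assume "h \<in> A"
    then have "x $ h \<le> eps * (g $ h - inner g x)"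
      by (simp add: A_def active_set_def inner_axis_diff g_def)
    also have "\<dots> \<le> eps * (g $ h - g $ j)"
      using argmin_gradient_le_inner[OF x(1) j] eps by (simp add: g_def)
    finally show "(x $ h)\<^sup>2 \<le> eps * (g $ h - g $ j) * x $ h"
      using x by (simp add: power2_eq_square mult_right_mono unit_simplex_def)
  qed
  also have "\<dots> = - eps * inner g v"
    unfolding gv sum_distrib_left by (intro sum.cong) (auto simp: algebra_simps)
  finally have first: "(\<Sum>h\<in>A. (x $ h)\<^sup>2) \<le> - eps * inner g v" .
  have "card (insert j A) \<le> CARD('n)"
    by (rule card_mono) auto
  then have card: "real (card A) + 1 \<le> real CARD('n)"
    using jA by simp
  \<comment> \<open>Cauchy-Schwarz; the second term in \<open>norm\<close> raises the factor to
    \<open>card A + 1\<close>.\<close>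
  have "s\<^sup>2 \<le> real (card A) * (\<Sum>h\<in>A. (x $ h)\<^sup>2)"
    unfolding s_def using sum_squared_le_sum_of_squares[of "\<lambda>h. x $ h" A] by (simp add: mult.commute)
  then have "(norm v)\<^sup>2 \<le> (real (card A) + 1) * (\<Sum>h\<in>A. (x $ h)\<^sup>2)"
    by (simp add: norm algebra_simps)
  also have "\<dots> \<le> real CARD('n) * (- eps * inner g v)"
    using card first by (intro mult_mono) (auto intro: sum_nonneg)
  finally show ?thesis by (simp add: v_def g_def)
qed

text \<open>Since \<open>?K = C * L + L / 2\<close> and the bound on \<open>eps\<close> says
  \<open>?K * (?n * eps) \<le> 1\<close>, the first-order decrease \<open>G\<close> is at least
  \<open>?K\<close> times the squared step. The share \<open>L / 2\<close> pays for the remainder in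
  \<open>descent_lemma\<close>, and \<open>C * L\<close> is left.\<close>

lemma active_set_update_decrease:
  fixes f :: "real^'n \<Rightarrow> real"
  assumes diff: "\<And>y. f differentiable (at y)"
    and L: "L > 0" and lip: "L-lipschitz_on unit_simplex (gradient f)" and C: "C > 0"
    and eps: "0 < eps" "eps \<le> 2 / (real CARD('n) * L * (2 * C + 1))"
    and x: "x \<in> unit_simplex" "\<not> stationary f x" and j: "j \<in> argmin_gradient f x"
    and xt: "active_set_update f eps j x \<in> unit_simplex"
  shows "f (active_set_update f eps j x) \<le> f x - C * L * (norm (active_set_update f eps j x - x))\<^sup>2"
proof -
  let ?v = "active_set_update f eps j x - x"
  let ?n = "real CARD('n)" and ?K = "L * (2 * C + 1) / 2"
  define G where "G = - inner (gradient f x) ?v"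
  have K: "?K > 0" using L C by simp
  have n: "?n * eps > 0" using eps by simp
  have "(norm ?v)\<^sup>2 \<le> (?n * eps) * G"
    using active_set_update_first_order[OF x j eps(1)] by (simp add: G_def algebra_simps)
  moreover from this have "G \<ge> 0"
    using n by (smt (verit) zero_le_power2 mult_pos_neg)
  moreover have "?K * (?n * eps) \<le> 1"
    using eps(2) L C by (simp add: pos_le_divide_eq mult_ac)
  ultimately have "?K * (norm ?v)\<^sup>2 \<le> ?K * ((?n * eps) * G)" "(?K * (?n * eps)) * G \<le> 1 * G"
    by (intro mult_left_mono mult_right_mono; use K in simp)+
  then have "?K * (norm ?v)\<^sup>2 \<le> G" by (simp add: mult.assoc)
  then show ?thesis
    using descent_lemma[OF diff convex_unit_simplex lip x(1) xt] by (simp add: G_def field_simps)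
qed

section \<open>The Armijo line search\<close>

text \<open>The feasible stepsizes form a closed set, which is bounded because the simplex is
  bounded and \<open>d \<noteq> 0\<close>; so the supremum is a maximum. Feasibility of the
  direction makes it positive.\<close>

lemma max_stepsize_attained:
  fixes d :: "real^'n"
  assumes feas: "feasible_direction x d" and d: "d \<noteq> 0"
  obtains m where "m > 0" "max_stepsize x d = ereal m" "x + m *\<^sub>R d \<in> unit_simplex"
proof -
  define S where "S = {a::real. x + a *\<^sub>R d \<in> unit_simplex}"
  obtain t where t: "t > 0" "\<And>a. 0 \<le> a \<Longrightarrow> a \<le> t \<Longrightarrow> a \<in> S"
    using feas by (auto simp: feasible_direction_def S_def)
  have "closed S"
    unfolding S_def vimage_def[symmetric, of "\<lambda>a. x + a *\<^sub>R d"]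
    by (intro closed_vimage closed_unit_simplex continuous_intros)
  moreover have "\<bar>a\<bar> \<le> (1 + norm x) / norm d" if "a \<in> S" for a
  proof -
    have "norm (a *\<^sub>R d) \<le> norm (x + a *\<^sub>R d) + norm x"
      using norm_triangle_ineq4[of "x + a *\<^sub>R d" x] by simp
    also have "\<dots> \<le> 1 + norm x"
      using that unit_simplex_norm_le by (simp add: S_def)
    finally show ?thesis using d by (simp add: field_simps)
  qed
  then have "bounded S" by (auto simp: bounded_iff)
  ultimately have "compact S" by (simp add: compact_eq_bounded_closed)
  then obtain m where m: "m \<in> S" "\<And>a. a \<in> S \<Longrightarrow> a \<le> m"
    using compact_attains_sup[of S] t(2)[of 0] t(1) by force
  have "(SUP a\<in>S. ereal a) = ereal m"
    by (rule antisym) (use m in \<open>auto intro: SUP_least SUP_upper\<close>)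
  then show ?thesis
    using that[of m] m m(2)[OF t(2)[of t]] t(1) by (auto simp: max_stepsize_def S_def)
qed

text \<open>The Armijo test leaves a slack of \<open>1 - gam\<close> times the linear decrease;
  \<open>small\<close> says that the quadratic remainder fits into it.\<close>

lemma armijo_condition:
  fixes f :: "real^'n \<Rightarrow> real"
  assumes diff: "\<And>y. f differentiable (at y)"
    and lip: "L-lipschitz_on unit_simplex (gradient f)"
    and x: "x \<in> unit_simplex" "x + a *\<^sub>R d \<in> unit_simplex" and a: "0 \<le> a"
    and small: "L / 2 * a * (norm d)\<^sup>2 \<le> (1 - gam) * (- inner (gradient f x) d)"
  shows "f (x + a *\<^sub>R d) \<le> f x + gam * a * inner (gradient f x) d"
proof -
  have "f (x + a *\<^sub>R d) \<le> f x + a * inner (gradient f x) d + a * (L / 2 * a * (norm d)\<^sup>2)"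
    using descent_lemma[OF diff convex_unit_simplex lip x] by (simp add: power_mult_distrib power2_eq_square algebra_simps)
  then show ?thesis
    using mult_left_mono[OF small a] by (simp add: algebra_simps)
qed

text \<open>The trial steps \<open>del ^ k * m\<close> tend to 0, so one of them satisfies the
  smallness condition of \<open>armijo_condition\<close>.\<close>

lemma armijo_search_terminates:
  fixes f :: "real^'n \<Rightarrow> real"
  assumes diff: "\<And>y. f differentiable (at y)"
    and lip: "L-lipschitz_on unit_simplex (gradient f)"
    and del: "0 < del" "del < 1" and gam: "gam < 1"
    and x: "x \<in> unit_simplex" and feas: "feasible_direction x d"
    and descent: "inner (gradient f x) d < 0"
  shows "armijo_search f del gam x d \<noteq> None"
proof -
  have "d \<noteq> 0" using descent by auto
  then obtain m where m: "m > 0" "max_stepsize x d = ereal m" "x + m *\<^sub>R d \<in> unit_simplex"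
    using max_stepsize_attained[OF feas] by blast
  have pow: "((\<lambda>a. del * a) ^^ k) m = del ^ k * m" for k
    by (induction k) auto
  have lim: "(\<lambda>k. L / 2 * (del ^ k * m) * (norm d)\<^sup>2) \<longlonglongrightarrow> L / 2 * (0 * m) * (norm d)\<^sup>2"
    by (intro tendsto_intros LIMSEQ_realpow_zero) (use del in auto)
  have pos: "0 < (1 - gam) * (- inner (gradient f x) d)"
    using gam descent by (simp add: mult_pos_neg)
  have ev: "\<forall>\<^sub>F k in sequentially.
      L / 2 * (del ^ k * m) * (norm d)\<^sup>2 < (1 - gam) * (- inner (gradient f x) d)"
    by (rule order_tendstoD(2)[OF lim]) (use pos in simp)
  obtain k where "L / 2 * (del ^ k * m) * (norm d)\<^sup>2 < (1 - gam) * (- inner (gradient f x) d)"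
    using eventually_happens[OF ev] by (auto simp only: sequentially_bot)
  then have k: "L / 2 * (del ^ k * m) * (norm d)\<^sup>2 \<le> (1 - gam) * (- inner (gradient f x) d)"
    by (rule less_imp_le)
  have "del ^ k * m \<le> 1 * m"
    using m(1) del by (intro mult_right_mono power_le_one) auto
  moreover have "0 \<le> del ^ k * m" using m(1) del by simp
  ultimately have "f (x + (del ^ k * m) *\<^sub>R d) \<le> f x + gam * (del ^ k * m) * inner (gradient f x) d"
    by (intro armijo_condition[OF diff lip x _ _ k] unit_simplex_stepI[OF x m(3)]; simp only: mult_1)
  then have "\<not> f (x + (del ^ k * m) *\<^sub>R d) > f x + gam * (del ^ k * m) * inner (gradient f x) d"
    by simp
  then have ex: "\<exists>k. \<not> f (x + ((\<lambda>a. del * a) ^^ k) m *\<^sub>R d)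
      > f x + gam * ((\<lambda>a. del * a) ^^ k) m * inner (gradient f x) d"
    unfolding pow by (rule exI[of _ k])
  \<comment> \<open>By definition \<open>while_option\<close> yields \<open>None\<close> only if the
    loop test holds at every iterate.\<close>
  show ?thesis
    unfolding armijo_search_def while_option_def m(2) real_of_ereal.simps if_P[OF ex] by (rule option.simps(3))
qed

text \<open>The last conclusion bounds the step from below: unless the first trial \<open>m\<close>
  is accepted, the trial \<open>a / del\<close> before \<open>a\<close> was rejected, so the
  smallness condition of \<open>armijo_condition\<close> fails for it.\<close>

lemma armijo_search_SomeD:
  fixes f :: "real^'n \<Rightarrow> real"
  assumes diff: "\<And>y. f differentiable (at y)"
    and lip: "L-lipschitz_on unit_simplex (gradient f)"
    and del: "0 < del" "del < 1"
    and x: "x \<in> unit_simplex"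
    and m: "max_stepsize x d = ereal m" "m > 0" "x + m *\<^sub>R d \<in> unit_simplex"
    and res: "armijo_search f del gam x d = Some a"
  shows "0 \<le> a" "a \<le> m" "f (x + a *\<^sub>R d) \<le> f x + gam * a * inner (gradient f x) d"
    "a = m \<or> L / 2 * (a / del) * (norm d)\<^sup>2 > (1 - gam) * (- inner (gradient f x) d)"
proof -
  let ?b = "\<lambda>a. f (x + a *\<^sub>R d) > f x + gam * a * inner (gradient f x) d"
  \<comment> \<open>The loop invariant remembers that the preceding trial was rejected, and that it
    was at most \<open>m\<close>, hence feasible.\<close>
  define P where "P = (\<lambda>a. 0 \<le> a \<and> a \<le> m \<and> (a = m \<or> (a / del \<le> m \<and> ?b (a / del))))"
  have w: "while_option ?b (\<lambda>a. del * a) m = Some a"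
    using res by (simp add: armijo_search_def m(1))
  show "f (x + a *\<^sub>R d) \<le> f x + gam * a * inner (gradient f x) d"
    using while_option_stop[OF w] by simp
  have "P (del * a)" if "P a" "?b a" for a
  proof -
    have "del * a \<le> 1 * a"
      using that del by (intro mult_right_mono) (auto simp: P_def)
    then show ?thesis using that del by (auto simp: P_def)
  qed
  then have P: "P a"
    by (rule while_option_rule[OF _ w]) (use m(2) in \<open>simp_all add: P_def\<close>)
  then show a: "0 \<le> a" "a \<le> m" by (auto simp: P_def)
  show "a = m \<or> L / 2 * (a / del) * (norm d)\<^sup>2 > (1 - gam) * (- inner (gradient f x) d)"
  proof (rule disjCI, rule ccontr)
    assume "\<not> L / 2 * (a / del) * (norm d)\<^sup>2 > (1 - gam) * (- inner (gradient f x) d)" "\<not> a = m"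
    then have small: "L / 2 * (a / del) * (norm d)\<^sup>2 \<le> (1 - gam) * (- inner (gradient f x) d)"
      and ad: "a / del \<le> m" "?b (a / del)" using P by (auto simp: P_def)
    have nonneg: "0 \<le> a / del" using a del by simp
    have "f (x + (a / del) *\<^sub>R d) \<le> f x + gam * (a / del) * inner (gradient f x) d"
      by (rule armijo_condition[OF diff lip x unit_simplex_stepI[OF x m(3) nonneg ad(1)] nonneg small])
    then show False
      using ad(2) by linarith
  qed
qed

section \<open>Runs of the algorithm\<close>

lemma armijo_stepsize_SomeD:
  fixes f :: "real^'n \<Rightarrow> real"
  assumes diff: "\<And>y. f differentiable (at y)"
    and lip: "L-lipschitz_on unit_simplex (gradient f)"
    and del: "0 < del" "del < 1" and gam: "0 < gam"
    and x: "x \<in> unit_simplex" and feas: "feasible_direction x d"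
    and res: "armijo_stepsize f del gam x d = Some a"
  shows "x + a *\<^sub>R d \<in> unit_simplex \<and> f (x + a *\<^sub>R d) \<le> f x"
proof (cases "inner (gradient f x) d < 0")
  case True
  then have "d \<noteq> 0" by auto
  then obtain m where m: "m > 0" "max_stepsize x d = ereal m" "x + m *\<^sub>R d \<in> unit_simplex"
    using max_stepsize_attained[OF feas] by blast
  have "armijo_search f del gam x d = Some a"
    using res True by (simp add: armijo_stepsize_def)
  note s = armijo_search_SomeD[OF diff lip del x m(2,1,3) this]
  have "gam * a * inner (gradient f x) d \<le> 0"
    using True gam s(1) by (simp add: mult_nonneg_nonpos)
  then show ?thesis
    using s(3) unit_simplex_stepI[OF x m(3) s(1,2)] by linarith
qed (use res x in \<open>simp add: armijo_stepsize_def\<close>)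

lemma feasible_direction_imp_in_unit_simplex: "feasible_direction x d \<Longrightarrow> x \<in> unit_simplex"
  by (force simp: feasible_direction_def)

section \<open>Infinite runs: vanishing decrease and properties of the steps\<close>

locale infinite_as_simplex_run =
  fixes f :: "real^'n \<Rightarrow> real"
    and L C eps del gam :: real
    and x xt d :: "nat \<Rightarrow> real^'n"
    and alpha :: "nat \<Rightarrow> real"
  assumes diff: "\<And>y. f differentiable (at y)"
    and cont: "continuous_on UNIV (gradient f)"
    and L: "L > 0"
    and lip: "L-lipschitz_on unit_simplex (gradient f)"
    and C: "C > 0"
    and eps: "0 < eps" "eps \<le> 2 / (real CARD('n) * L * (2 * C + 1))"
    and del: "0 < del" "del < 1"
    and gam: "0 < gam" "gam < 1"
    and run: "as_simplex_run f eps del gam \<infinity> x xt d alpha"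
    and related: "active_set_gradient_related f eps x xt d"
begin

lemma not_stationary: "\<not> stationary f (x k)"
  and step: "direction_step f eps (x k) (xt k) (d k)"
  and stepsize: "armijo_stepsize f del gam (xt k) (d k) = Some (alpha k)"
  and x_Suc: "x (Suc k) = xt k + alpha k *\<^sub>R d k"
  using run by (auto simp: as_simplex_run_def)

lemma feasible: "feasible_direction (xt k) (d k)"
  using step by (simp add: direction_step_def)

lemmas xt_in = feasible_direction_imp_in_unit_simplex[OF feasible]
lemmas stepsizeD = armijo_stepsize_SomeD[OF diff lip del gam(1) xt_in feasible stepsize, folded x_Suc]

lemma x_in: "x k \<in> unit_simplex"
  using run stepsizeD by (cases k) (auto simp: as_simplex_run_def)

lemma xt_decrease: "f (xt k) \<le> f (x k) - C * L * (norm (xt k - x k))\<^sup>2"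
proof -
  obtain j where j: "j \<in> argmin_gradient f (x k)" "xt k = active_set_update f eps j (x k)"
    using step by (auto simp: direction_step_def)
  show ?thesis
    by (rule active_set_update_decrease[OF diff L lip C eps x_in not_stationary j(1),
          folded j(2), OF xt_in])
qed

text \<open>The values decrease in both stages of an iteration and are bounded below on the compact
  simplex, so they converge.\<close>

lemma f_x_diff_tendsto_0: "(\<lambda>k. f (x k) - f (x (Suc k))) \<longlonglongrightarrow> 0"
proof -
  have "continuous_on unit_simplex f"
    using diff by (simp add: continuous_at_imp_continuous_on differentiable_imp_continuous_within)
  then have "compact (f ` unit_simplex)"
    by (rule compact_continuous_image[OF _ compact_unit_simplex])
  then obtain B where B: "\<And>y. y \<in> unit_simplex \<Longrightarrow> \<bar>f y\<bar> \<le> B"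
    using compact_imp_bounded bounded_iff by (metis imageI real_norm_def)
  have "f (x (Suc k)) \<le> f (x k)" for k
    using stepsizeD[of k] xt_decrease[of k] L C by (smt (verit) mult_nonneg_nonneg zero_le_power2)
  then have "decseq (\<lambda>k. f (x k))" by (simp add: decseq_Suc_iff)
  then obtain l where l: "(\<lambda>k. f (x k)) \<longlonglongrightarrow> l"
    using decseq_convergent[of "\<lambda>k. f (x k)" "-B"] B[OF x_in] by (metis abs_le_D2 minus_le_iff)
  then show ?thesis
    using tendsto_diff[OF l LIMSEQ_Suc[OF l]] by simp
qed

text \<open>Isolates the share of the line search in the decrease; it is squeezed since
  \<open>f (xt k)\<close> lies between \<open>f (x (Suc k))\<close> and
  \<open>f (x k)\<close>.\<close>

lemma f_xt_diff_tendsto_0: "(\<lambda>k. f (xt k) - f (x (Suc k))) \<longlonglongrightarrow> 0"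
proof (rule tendsto_sandwich[OF _ _ tendsto_const f_x_diff_tendsto_0])
  show "\<forall>\<^sub>F k in sequentially. 0 \<le> f (xt k) - f (x (Suc k))"
    using stepsizeD by simp
  have "f (xt k) \<le> f (x k)" for k
    using xt_decrease[of k] L C by (smt (verit) mult_nonneg_nonneg zero_le_power2)
  then show "\<forall>\<^sub>F k in sequentially. f (xt k) - f (x (Suc k)) \<le> f (x k) - f (x (Suc k))"
    by simp
qed

lemma xt_minus_x_tendsto_0: "(\<lambda>k. xt k - x k) \<longlonglongrightarrow> 0"
proof -
  have "(\<lambda>k. (norm (xt k - x k))\<^sup>2) \<longlonglongrightarrow> 0"
  proof (rule tendsto_sandwich[OF _ _ tendsto_const])
    show "\<forall>\<^sub>F k in sequentially. (norm (xt k - x k))\<^sup>2 \<le> (f (x k) - f (x (Suc k))) / (C * L)"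
    proof (rule always_eventually, rule allI)
      fix k
      have "C * L * (norm (xt k - x k))\<^sup>2 \<le> f (x k) - f (x (Suc k))"
        using stepsizeD[of k] xt_decrease[of k] by linarith
      then show "(norm (xt k - x k))\<^sup>2 \<le> (f (x k) - f (x (Suc k))) / (C * L)"
        using L C by (simp add: pos_le_divide_eq mult.commute)
    qed
    show "(\<lambda>k. (f (x k) - f (x (Suc k))) / (C * L)) \<longlonglongrightarrow> 0"
      using tendsto_divide[OF f_x_diff_tendsto_0 tendsto_const[of "C * L"]] L C by simp
  qed simp
  then have "(\<lambda>k. sqrt ((norm (xt k - x k))\<^sup>2)) \<longlonglongrightarrow> sqrt 0"
    by (rule tendsto_real_sqrt)
  then show ?thesis by (simp add: tendsto_norm_zero_iff)
qed

text \<open>The one index that receives mass is nonactive, so every active component is really reset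
  to zero.\<close>

lemma xt_active: "i \<notin> nonactive_set f eps (x k) \<Longrightarrow> xt k $ i = 0"
proof -
  assume "i \<notin> nonactive_set f eps (x k)"
  then have i: "i \<in> active_set f eps (x k)"
    by (auto simp: nonactive_set_def active_set_def)
  obtain j where j: "j \<in> argmin_gradient f (x k)" "xt k = active_set_update f eps j (x k)"
    using step by (auto simp: direction_step_def)
  then have "j \<noteq> i"
    using argmin_gradient_not_active[OF x_in not_stationary j(1) eps(1)] i by auto
  then show ?thesis using i j by (simp add: active_set_update_def)
qed

text \<open>Directions vanish on the active set, so the subvector conditions of gradient relatedness
  turn into conditions on full vectors.\<close>

lemma inner_subvector:
  assumes "nonactive_set f eps (x k) = I"
  shows "subvector I (d k) = d k" "inner (subvector I g) (d k) = inner g (d k)"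
proof -
  have zero: "d k $ i = 0" if "i \<notin> I" for i
    using that step[of k] assms by (auto simp: direction_step_def nonactive_set_def active_set_def not_less)
  then show "subvector I (d k) = d k"
    by (auto simp: subvector_def vec_eq_iff)
  show "inner (subvector I g) (d k) = inner g (d k)"
    by (auto simp: inner_vec_def subvector_def zero intro!: sum.cong)
qed

text \<open>Either the maximal step is accepted, which exceeds \<open>c\<close>, or the rejected
  trial forces \<open>alpha k\<close> to be at least the second argument of \<open>min\<close>. The
  Armijo test turns this into a decrease.\<close>

lemma stepsize_lower_bound:
  assumes descent: "inner (gradient f (xt k)) (d k) < - eta" and eta: "eta > 0"
    and M: "norm (d k) \<le> M" "M > 0"
    and c: "max_stepsize (xt k) (d k) > ereal c"
  shows "gam * eta * min c (2 * del * (1 - gam) * eta / (L * M\<^sup>2)) \<le> f (xt k) - f (x (Suc k))"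
proof -
  let ?q = "2 * del * (1 - gam) * eta / (L * M\<^sup>2)"
  have neg: "inner (gradient f (xt k)) (d k) < 0" using descent eta by simp
  then have "d k \<noteq> 0" by auto
  then obtain m where m: "m > 0" "max_stepsize (xt k) (d k) = ereal m" "xt k + m *\<^sub>R d k \<in> unit_simplex"
    using max_stepsize_attained[OF feasible] by blast
  have "armijo_search f del gam (xt k) (d k) = Some (alpha k)"
    using stepsize[of k] neg by (simp add: armijo_stepsize_def)
  note s = armijo_search_SomeD[OF diff lip del xt_in m(2,1,3) this, folded x_Suc]
  have "min c ?q \<le> alpha k"
  proof (cases "alpha k = m")
    case True
    then show ?thesis using c m(2) by simp
  next
    case False
    have "(1 - gam) * eta \<le> (1 - gam) * (- inner (gradient f (xt k)) (d k))"
      using descent gam by (intro mult_left_mono) auto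
    also have "\<dots> \<le> L / 2 * (alpha k / del) * (norm (d k))\<^sup>2"
      using s(4) False by simp
    also have "\<dots> \<le> L / 2 * (alpha k / del) * M\<^sup>2"
      using s(1) L del M by (intro mult_left_mono power_mono) auto
    finally have "?q \<le> alpha k"
      using L del M by (simp add: field_simps)
    then show ?thesis by simp
  qed
  then have "gam * eta * min c ?q \<le> gam * eta * alpha k"
    using gam eta by (intro mult_left_mono) auto
  also have "\<dots> = gam * alpha k * eta" by simp
  also have "\<dots> \<le> gam * alpha k * (- inner (gradient f (xt k)) (d k))"
    using descent gam s(1) by (intro mult_left_mono) auto
  also have "\<dots> \<le> f (xt k) - f (x (Suc k))"
    using s(3) by simp
  finally show ?thesis .
qed

section \<open>Stationarity of limit points\<close>

lemma face_limit_stationary: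
  assumes r: "strict_mono r" and I: "\<And>k. nonactive_set f eps (x (r k)) = I"
    and lim: "(\<lambda>k. x (r k)) \<longlonglongrightarrow> xs" and xs: "xs \<in> simplex_face I"
  shows "stationary_in_face f I xs"
proof (rule ccontr)
  assume "\<not> stationary_in_face f I xs"
  then have bdd: "bounded (range (\<lambda>k. subvector I (d (r k))))"
    and sup: "limsup (\<lambda>k. ereal (inner (subvector I (gradient f (xt (r k)))) (subvector I (d (r k))))) < 0"
    and inf: "liminf (\<lambda>k. max_stepsize (xt (r k)) (d (r k))) > 0"
    using related[unfolded active_set_gradient_related_def, rule_format, of r I xs] r I lim xs
    by auto
  obtain M where M: "M > 0" "\<And>k. norm (d (r k)) \<le> M"
    using bdd by (auto simp: bounded_pos inner_subvector[OF I])
  \<comment> \<open>Here \<open>eta\<close> is negative, so \<open>stepsize_lower_bound\<close> is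
    applied with \<open>- eta\<close>.\<close>
  obtain eta where "limsup (\<lambda>k. ereal (inner (gradient f (xt (r k))) (d (r k)))) < ereal eta" "ereal eta < 0"
    using ereal_dense2[OF sup] by (auto simp: inner_subvector[OF I])
  then have eta: "- eta > 0" "\<forall>\<^sub>F k in sequentially. inner (gradient f (xt (r k))) (d (r k)) < - (- eta)"
    by (auto dest: Limsup_lessD)
  obtain c where c: "ereal c > 0" "ereal c < liminf (\<lambda>k. max_stepsize (xt (r k)) (d (r k)))"
    using ereal_dense2[OF inf] by auto
  \<comment> \<open>A positive decrease independent of \<open>k\<close>, which contradicts
    \<open>f_xt_diff_tendsto_0\<close>.\<close>
  define q where "q = gam * (- eta) * min c (2 * del * (1 - gam) * (- eta) / (L * M\<^sup>2))"
  have "q > 0"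
    using gam eta(1) c(1) del L M(1) by (simp add: q_def mult_pos_neg mult_neg_pos divide_neg_pos)
  have "\<forall>\<^sub>F k in sequentially. q \<le> f (xt (r k)) - f (x (Suc (r k)))"
    using eta(2) less_LiminfD[OF c(2)]
  proof eventually_elim
    case (elim k)
    then show ?case
      unfolding q_def by (rule stepsize_lower_bound[OF _ eta(1) M(2,1)])
  qed
  moreover have "\<forall>\<^sub>F k in sequentially. f (xt (r k)) - f (x (Suc (r k))) < q"
    using LIMSEQ_subseq_LIMSEQ[OF f_xt_diff_tendsto_0 r] \<open>q > 0\<close>
    by (intro order_tendstoD) (auto simp: o_def)
  ultimately have "\<forall>\<^sub>F k in sequentially. False"
    by eventually_elim simp
  then show False by simp
qed

lemma limit_point_stationary:
  assumes "seq_limit_point x xs"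
  shows "stationary f xs"
proof -
  obtain r0 where r0: "strict_mono r0" "(\<lambda>k. x (r0 k)) \<longlonglongrightarrow> xs"
    using assms by (auto simp: seq_limit_point_def)
  \<comment> \<open>There are finitely many index sets, so one of them recurs infinitely
    often.\<close>
  obtain k0 where k0: "infinite {k. nonactive_set f eps (x (r0 k)) = nonactive_set f eps (x (r0 k0))}"
    using pigeonhole_infinite[OF infinite_UNIV_nat finite, of "\<lambda>k. nonactive_set f eps (x (r0 k))"]
    by auto
  obtain s :: "nat \<Rightarrow> nat" where s: "strict_mono s"
    "\<And>k. nonactive_set f eps (x (r0 (s k))) = nonactive_set f eps (x (r0 k0))"
    using infinite_enumerate[OF k0] by auto
  define r I where "r = r0 \<circ> s" and "I = nonactive_set f eps (x (r0 k0))"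
  have r: "strict_mono r"
    using r0(1) s(1) by (simp add: r_def strict_mono_o)
  have I: "nonactive_set f eps (x (r k)) = I" for k
    by (simp add: r_def I_def s)
  have lim: "(\<lambda>k. x (r k)) \<longlonglongrightarrow> xs"
    using LIMSEQ_subseq_LIMSEQ[OF r0(2) s(1)] by (simp add: r_def o_def)
  \<comment> \<open>The iterates \<open>x (r k)\<close> may be nonzero outside \<open>I\<close>, but
    the points \<open>xt (r k)\<close> vanish there and have the same limit.\<close>
  have "(\<lambda>k. (xt (r k) - x (r k)) + x (r k)) \<longlonglongrightarrow> 0 + xs"
    using LIMSEQ_subseq_LIMSEQ[OF xt_minus_x_tendsto_0 r] lim by (intro tendsto_add) (simp_all add: o_def)
  then have xt_lim: "(\<lambda>k. xt (r k) $ i) \<longlonglongrightarrow> xs $ i" for i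
    by (intro tendsto_vec_nth) simp
  have "xs $ i = 0" if "i \<notin> I" for i
  proof -
    have "xt (r k) $ i = 0" for k
      using that by (intro xt_active) (simp add: I)
    then show ?thesis
      using xt_lim[of i] by (simp add: LIMSEQ_const_iff)
  qed
  moreover have xs: "xs \<in> unit_simplex"
    using closed_sequentially[OF closed_unit_simplex _ lim] x_in by blast
  ultimately have face: "xs \<in> simplex_face I"
    by (simp add: simplex_face_def)
  show ?thesis
  proof (rule stationaryI[OF xs])
    fix i
    show "inner (gradient f xs) (axis i 1 - xs) \<ge> 0"
    \<comment> \<open>For \<open>i \<in> I\<close> the vertex \<open>axis i 1\<close> is a test
      point of the face. Otherwise \<open>i\<close> is active at every \<open>x (r k)\<close>, where
      \<open>0 \<le> x (r k) $ i\<close> and \<open>eps > 0\<close> give the sign.\<close>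
    proof (cases "i \<in> I")
      case True
      then show ?thesis
        using face_limit_stationary[OF r I lim face] axis_in_simplex_face
        by (auto simp: stationary_in_face_def)
    next
      case False
      have "isCont (gradient f) xs"
        using cont by (simp add: continuous_on_eq_continuous_at)
      then have "(\<lambda>k. gradient f (x (r k))) \<longlonglongrightarrow> gradient f xs"
        by (rule isCont_tendsto_compose[OF _ lim])
      then have "(\<lambda>k. inner (gradient f (x (r k))) (axis i 1 - x (r k)))
          \<longlonglongrightarrow> inner (gradient f xs) (axis i 1 - xs)"
        by (intro tendsto_intros lim)
      moreover have "inner (gradient f (x (r k))) (axis i 1 - x (r k)) \<ge> 0" for k
      proof -
        have "0 \<le> x (r k) $ i"
          using x_in by (simp add: unit_simplex_def)
        also have "\<dots> \<le> eps * inner (gradient f (x (r k))) (axis i 1 - x (r k))"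
          using False I[of k] by (auto simp: nonactive_set_def not_less)
        finally show ?thesis using eps(1) by (simp add: zero_le_mult_iff)
      qed
      ultimately show ?thesis
        by (intro tendsto_lowerbound[OF _ always_eventually]) auto
    qed
  qed
qed

end

theorem theorem2:
  fixes f :: "real^'n \<Rightarrow> real"
    and L C eps del gam :: real
    and T :: enat
    and x xt d :: "nat \<Rightarrow> real^'n"
    and alpha :: "nat \<Rightarrow> real"
  assumes "\<And>y. f differentiable (at y)"
    and "continuous_on UNIV (gradient f)"
    and "L > 0"
    and "L-lipschitz_on unit_simplex (gradient f)"
    and "C > 0"
    and "0 < eps" and "eps \<le> 2 / (real CARD('n) * L * (2 * C + 1))"
    and "0 < del" and "del < 1"
    and "0 < gam" and "gam < 1"
    and "as_simplex_run f eps del gam T x xt d alpha"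
    and "T = \<infinity> \<Longrightarrow> active_set_gradient_related f eps x xt d"
  shows "(\<exists>k. enat k \<le> T \<and> stationary f (x k)) \<or>
         (T = \<infinity> \<and> (\<forall>xs. seq_limit_point x xs \<longrightarrow> stationary f xs))"
proof (cases T)
  case (enat k)
  then consider "stationary f (x k)"
    | "direction_step f eps (x k) (xt k) (d k)" "armijo_stepsize f del gam (xt k) (d k) = None"
    using assms(12) by (auto simp: as_simplex_run_def)
  then show ?thesis
  proof cases
    case 1
    then show ?thesis using enat by auto
  next
    case 2
    then have feas: "feasible_direction (xt k) (d k)" by (simp add: direction_step_def)
    \<comment> \<open>A finite run without a stationary last iterate would need a line search that
      never stops.\<close>
    have False
      using 2(2) armijo_search_terminates[OF assms(1,4,8,9,11) feasible_direction_imp_in_unit_simplex[OF feas] feas]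
      by (auto simp: armijo_stepsize_def split: if_splits)
    then show ?thesis ..
  qed
next
  case infinity
  interpret infinite_as_simplex_run f L C eps del gam x xt d alpha
    by unfold_locales (use assms infinity in auto)
  show ?thesis
    using limit_point_stationary infinity by blast
qed

end
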